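(* Let $H$ be a real Hilbert space, let $\tilde f\colon H\to(-\infty,\infty]$ be proper, lower semicontinuous and strongly convex with constant $\gamma>0$, and let $\tilde g\colon H\to(-\infty,\infty]$ be proper, lower semicontinuous and weakly convex with constant $\omega>0$. Assume $\gamma>\omega$, $\beta\in(0,1)$, and let $\{r_k\}_{k\ge0}\subset(0,2(1-\beta)/\beta)$ satisfy $r_{k+1}=r_k/\sqrt{1+2r_k(1-\beta)/\beta}$ for all $k\ge0$. Put $$f:=\frac{1}{\gamma-\omega}\left(\tilde f-\frac{\gamma}{2}\Vert\cdot\Vert^2\right),\qquad g:=\frac{1}{\gamma-\omega}\left(\tilde g+\frac{\omega}{2}\Vert\cdot\Vert^2\right).$$ Let $z_0\in H$, $$x_0=\beta\,\mathrm{prox}_{\frac{2r_0(1-\beta)}{\beta+r_0(1-\beta)}f}\left(\frac{1}{\beta+r_0(1-\beta)}z_0\right),\qquad y_0=\frac1{r_0}(z_0-x_0),$$ and for $k=1,2,\dots$ $$x_k=\beta\,\mathrm{prox}_{\frac{2r_{k-1}(1-\beta)}{\beta+r_{k-1}(1-\beta)}f}\left(\frac{1}{\beta+r_{k-1}(1-\beta)}(z_{k-1}+r_{k-1}y_{k-1})\right),$$ $$y_k=\frac1{r_{k-1}}(z_{k-1}+r_{k-1}y_{k-1}-x_k),$$ $$z_k=\beta\,\mathrm{prox}_{\frac{2r_k(1-\beta)}{\beta+r_k(1-\beta)}g}\left(\frac{1}{\beta+r_k(1-\beta)}(x_k-r_ky_k)\right).$$ Let $r>0$ and $T:=(2J_{r(B_0)^{(\beta)}}-I)\circ(2J_{r(A_0)^{(\beta)}}-I)$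 with $A:=\partial f$ and $B:=\partial g$. Then: (i) $J_{\partial f+\partial g}(0)$ exists if and only if there exists $x\in H$ such that $\{T^k(x)\}$ is bounded; (ii) if $J_{\partial f+\partial g}(0)$ exists, then $\{\frac1\beta x_k\}$ converges strongly (in norm) to $x^*$, and $\Vert\frac1\beta x_{k+1}-x^*\Vert=O(1/k)$ as $k\to\infty$, where $x^*$ is the unique minimizer of $\tilde f+\tilde g$ over $H$.
   Context: $I$ is the identity on $H$. A function $h$ is strongly convex with constant $\gamma>0$ if $h((1-\lambda)x+\lambda y)\le(1-\lambda)h(x)+\lambda h(y)-\frac{\gamma\lambda(1-\lambda)}{2}\Vert x-y\Vert^2$ for all $x,y\in H$, $\lambda\in(0,1)$; it is weakly convex with constant $\omega>0$ if $h+\frac\omega2\Vert\cdot\Vert^2$ is convex. Hence $f$ and $g$ in the claim are proper, lsc and convex. $\partial$ denotes the convex subdifferential (maximal monotone for proper lsc convex functions). For a proper lsc convex $h$ and $\rho>0$, $\mathrm{prox}_{\rho h}(x)=\mathrm{argmin}_{y\in H}\{h(y)+\frac{1}{2\rho}\Vert y-x\Vert^2\}$. For a maximal monotone operator $M$ on $H$ and $\rho>0$, $J_{\rho M}=(I+\rho M)^{-1}$ (single-valued on all of $H$). "$J_{\partial f+\partial g}(0)$ exists" means that there is $u\in H$ with $0\in u+\partial f(u)+\partial g(u)$ (such $u$ is then unique and is denoted $J_{\partial f+\partial g}(0)$). For an operator $M\colon H\rightrightarrows H$, $(M_0)^{(\beta)}\colon H\rightrightarrows H$ is defined by $$(M_0)^{(\beta)}(x)=2(1-\beta)M\left(\frac1\beta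 x\right)+\frac{1-\beta}{\beta}x;$$ it is maximal monotone when $M$ is. *)

theory Defs
  imports "HOL-Analysis.Analysis" "HOL-Library.Landau_Symbols" "HOL-Library.Set_Algebras"
begin

text \<open>
  A real Hilbert space is a type of sort \<open>{real_inner, complete_space}\<close>. Functions into
  \<open>(-\<infinity>, \<infinity>]\<close> are \<open>ereal\<close>-valued functions; the value \<open>-\<infinity>\<close> is excluded by properness.
  Set-valued operators on \<open>H\<close> are functions of type \<open>'a \<Rightarrow> 'a set\<close>.
\<close>

definition proper_fun :: "('a \<Rightarrow> ereal) \<Rightarrow> bool" where
  "proper_fun h \<longleftrightarrow> (\<forall>x. h x \<noteq> -\<infinity>) \<and> (\<exists>x. h x \<noteq> \<infinity>)"

definition lsc_fun :: "('a::topological_space \<Rightarrow> ereal) \<Rightarrow> bool" where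
  "lsc_fun h \<longleftrightarrow> (\<forall>x. h x \<le> Liminf (at x) h)"

definition convex_fun :: "('a::real_vector \<Rightarrow> ereal) \<Rightarrow> bool" where
  "convex_fun h \<longleftrightarrow> (\<forall>x y. \<forall>l\<in>{0<..<1::real}.
     h ((1 - l) *\<^sub>R x + l *\<^sub>R y) \<le> ereal (1 - l) * h x + ereal l * h y)"

definition strongly_convex_fun :: "real \<Rightarrow> ('a::real_normed_vector \<Rightarrow> ereal) \<Rightarrow> bool" where
  "strongly_convex_fun c h \<longleftrightarrow> (\<forall>x y. \<forall>l\<in>{0<..<1::real}.
     h ((1 - l) *\<^sub>R x + l *\<^sub>R y)
       \<le> ereal (1 - l) * h x + ereal l * h y - ereal (c * l * (1 - l) / 2 * (norm (x - y))\<^sup>2))"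

definition weakly_convex_fun :: "real \<Rightarrow> ('a::real_normed_vector \<Rightarrow> ereal) \<Rightarrow> bool" where
  "weakly_convex_fun w h \<longleftrightarrow> convex_fun (\<lambda>x. h x + ereal (w / 2 * (norm x)\<^sup>2))"

text \<open>For proper \<open>h\<close> the set below is empty at every point where \<open>h\<close> takes the value \<open>\<infinity>\<close>.\<close>

definition subdiff :: "('a::real_inner \<Rightarrow> ereal) \<Rightarrow> 'a \<Rightarrow> 'a set" where
  "subdiff h x = {u. \<forall>y. h x + ereal (inner u (y - x)) \<le> h y}"

definition prox :: "real \<Rightarrow> ('a::real_normed_vector \<Rightarrow> ereal) \<Rightarrow> 'a \<Rightarrow> 'a" where
  "prox \<rho> h x = arg_min (\<lambda>y. h y + ereal (1 / (2 * \<rho>) * (norm (y - x))\<^sup>2)) (\<lambda>_. True)"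

text \<open>
  The set-valued map \<open>(I + \<rho>M)\<inverse>\<close>, and its value \<open>J\<^bsub>\<rho>M\<^esub> p\<close> at points where it is a singleton (at every
  point if \<open>M\<close> is maximal monotone and \<open>\<rho> > 0\<close>). That \<open>J\<^bsub>M\<^esub> p\<close> exists for an operator \<open>M\<close> which need
  not be maximal means that \<open>resolvent_set 1 M p\<close> is nonempty.
\<close>

definition resolvent_set :: "real \<Rightarrow> ('a::real_vector \<Rightarrow> 'a set) \<Rightarrow> 'a \<Rightarrow> 'a set" where
  "resolvent_set \<rho> M p = {u. \<exists>v\<in>M u. p = u + \<rho> *\<^sub>R v}"

definition resolvent :: "real \<Rightarrow> ('a::real_vector \<Rightarrow> 'a set) \<Rightarrow> 'a \<Rightarrow> 'a" where
  "resolvent \<rho> M p = the_elem (resolvent_set \<rho> M p)"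

definition reflected_resolvent :: "real \<Rightarrow> ('a::real_vector \<Rightarrow> 'a set) \<Rightarrow> 'a \<Rightarrow> 'a" where
  "reflected_resolvent \<rho> M p = 2 *\<^sub>R resolvent \<rho> M p - p"

text \<open>The operator \<open>(M\<^sub>0)\<^bsup>(\<beta>)\<^esup>\<close>, that is \<open>x \<mapsto> 2(1-\<beta>) M(x/\<beta>) + ((1-\<beta>)/\<beta>) x\<close>.\<close>

definition beta_op :: "real \<Rightarrow> ('a::real_vector \<Rightarrow> 'a set) \<Rightarrow> 'a \<Rightarrow> 'a set" where
  "beta_op \<beta> M x =
     (\<lambda>v. (2 * (1 - \<beta>)) *\<^sub>R v + ((1 - \<beta>) / \<beta>) *\<^sub>R x) ` M ((1 / \<beta>) *\<^sub>R x)"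

end

theory Submission
  imports Defs
begin

text \<open>
  Write \<open>A\<close> and \<open>B\<close> for the subdifferentials of \<open>f\<close> and \<open>g\<close>. The transformation
  \<open>x \<mapsto> 2(1 - \<beta>) M(x/\<beta>) + ((1 - \<beta>)/\<beta>) x\<close> turns \<open>A\<close> and \<open>B\<close> into operators \<open>A'\<close> and \<open>B'\<close> that are strongly
  monotone with modulus \<open>m = (1 - \<beta>)/\<beta>\<close>, and \<open>x\<close> is a zero of \<open>A' + B'\<close> exactly if \<open>u = x/\<beta>\<close> solves
  \<open>0 \<in> u + A u + B u\<close> (lemma \<open>beta_op_common_zero_iff\<close>). The prescribed proximal steps are resolvents
  of \<open>A'\<close> and \<open>B'\<close> (lemma \<open>prox_in_resolvent_set_beta_op\<close>), so the iteration is
  Douglas--Rachford splitting for \<open>A' + B'\<close> with variable step sizes.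

  For the existence part, \<open>T\<close> is a composition of reflected resolvents of monotone operators,
  hence nonexpansive, and its fixed points correspond to the zeros of \<open>A' + B'\<close>
  (lemma \<open>reflected_resolvent_comp_fixpoint_iff\<close>). In a Hilbert space
  a nonexpansive map has a fixed point if and only if it has a bounded orbit: the asymptotic
  centre of a bounded orbit is fixed (lemma \<open>nonexpansive_bounded_orbit_fixpoint\<close>).

  For the convergence part, let \<open>xs\<close> be a zero of \<open>A' + B'\<close> with \<open>a \<in> A' xs\<close> and \<open>-a \<in> B' xs\<close>. Strong
  monotonicity of \<open>A'\<close> and monotonicity of \<open>B'\<close> give, for \<open>k \<ge> 1\<close>,
  \<open>(1 + 2r\<^sub>km) \<parallel>x\<^sub>k\<^sub>+\<^sub>1 - xs\<parallel>\<^sup>2 + r\<^sub>k\<^sup>2 \<parallel>y\<^sub>k\<^sub>+\<^sub>1 - a\<parallel>\<^sup>2 \<le> \<parallel>x\<^sub>k - xs\<parallel>\<^sup>2 + r\<^sub>k\<^sup>2 \<parallel>y\<^sub>k - a\<parallel>\<^sup>2\<close>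
  (lemma \<open>Douglas_Rachford_energy_decrease\<close>). The step sizes satisfy \<open>r\<^sub>k\<^sub>+\<^sub>1\<^sup>2 = r\<^sub>k\<^sup>2 / (1 + 2r\<^sub>km)\<close>, so
  dividing by \<open>r\<^sub>k\<^sup>2\<close> makes the energies \<open>\<parallel>x\<^sub>k - xs\<parallel>\<^sup>2 / r\<^sub>k\<^sup>2 + \<parallel>y\<^sub>k - a\<parallel>\<^sup>2\<close> nonincreasing, and the error
  is \<open>O(r\<^sub>k) = O(1/k)\<close>. Finally \<open>f + g\<close> plus half the squared norm is a positive multiple of
  \<open>ft + gt\<close>, whence \<open>xs/\<beta>\<close> is its unique minimizer (lemma \<open>resolvent_at_zero_unique_minimizer\<close>).
\<close>


section \<open>Minimizers of strongly convex functions\<close>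

text \<open>
  By the midpoint inequality the sublevel sets slightly above the infimum have diameters tending
  to \<open>0\<close>, so completeness gives a common point of them all. Strong convexity is phrased through real
  upper bounds of \<open>F\<close>, which avoids arithmetic with infinite values. The lemma serves twice: for the
  objective of the proximal map, and for asymptotic centres.
\<close>
lemma strongly_convex_minimizer_exists:
  fixes F :: "'a::{real_inner, complete_space} \<Rightarrow> ereal"
  assumes c: "c > 0"
    and midpoint: "\<And>x y a b. F x \<le> ereal a \<Longrightarrow> F y \<le> ereal b \<Longrightarrow>
      F ((1 / 2) *\<^sub>R (x + y)) \<le> ereal ((a + b) / 2 - c * (norm (x - y))\<^sup>2)"
    and bounded_below: "\<And>x. ereal m \<le> F x"
    and finite: "F x0 \<noteq> \<infinity>"
    and closed: "\<And>a. closed {x. F x \<le> ereal a}"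
  shows "\<exists>u. \<forall>y. F u \<le> F y"
proof -
  define i where "i = (INF x. F x)"
  have "i \<le> F x0" "ereal m \<le> i"
    using bounded_below by (auto simp: i_def intro: INF_lower INF_greatest)
  with finite obtain d where d: "i = ereal d" by (cases i; cases "F x0") auto
  have d_le: "ereal d \<le> F x" for x unfolding d[symmetric] i_def by (rule INF_lower) simp
  define S where "S n = {x. F x \<le> ereal (d + 1 / real (Suc n))}" for n
  have "\<exists>u. \<forall>n. u \<in> S n"
  proof (rule decreasing_closed_nest[of S])
    show "closed (S n)" for n unfolding S_def by (rule closed)
    show "S n \<noteq> {}" for n
    proof -
      have "i < ereal (d + 1 / real (Suc n))" unfolding d by simp
      then obtain x where "F x < ereal (d + 1 / real (Suc n))"
        unfolding i_def INF_less_iff by auto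
      then show ?thesis unfolding S_def by (auto intro: less_imp_le)
    qed
    show "m \<le> n \<Longrightarrow> S n \<subseteq> S m" for m n
    proof -
      assume "m \<le> n"
      then have "1 / real (Suc n) \<le> 1 / real (Suc m)" by (simp add: frac_le)
      then have "ereal (d + 1 / real (Suc n)) \<le> ereal (d + 1 / real (Suc m))" by simp
      then show ?thesis unfolding S_def by (auto intro: order_trans)
    qed
    show "\<exists>n. \<forall>x\<in>S n. \<forall>y\<in>S n. dist x y < e" if "e > 0" for e
    proof -
      obtain n where n: "inverse (real (Suc n)) < c * e\<^sup>2"
        using reals_Archimedean[of "c * e\<^sup>2"] c \<open>e > 0\<close> by auto
      have "dist x y < e" if "x \<in> S n" "y \<in> S n" for x y
      proof -
        have "F ((1 / 2) *\<^sub>R (x + y)) \<le> ereal (d + 1 / real (Suc n) - c * (norm (x - y))\<^sup>2)"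
          using midpoint[of x "d + 1 / real (Suc n)" y "d + 1 / real (Suc n)"] that
          by (simp add: S_def add_divide_distrib del: of_nat_Suc)
        with d_le[of "(1 / 2) *\<^sub>R (x + y)"]
        have "ereal d \<le> ereal (d + 1 / real (Suc n) - c * (norm (x - y))\<^sup>2)" by (rule order_trans)
        with n have "c * (norm (x - y))\<^sup>2 < c * e\<^sup>2" by (simp add: inverse_eq_divide)
        with c have "(norm (x - y))\<^sup>2 < e\<^sup>2" by simp
        then show ?thesis using \<open>e > 0\<close> by (simp add: dist_norm power2_less_imp_less)
      qed
      then show ?thesis by blast
    qed
  qed auto
  then obtain u where u: "F u \<le> ereal (d + 1 / real (Suc n))" for n unfolding S_def by auto
  have "F u \<le> ereal d"
  proof (rule tendsto_lowerbound)
    have "(\<lambda>n. d + 1 / real (Suc n)) \<longlonglongrightarrow> d + 0"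
      by (intro tendsto_add tendsto_const LIMSEQ_Suc lim_1_over_n)
    then show "(\<lambda>n. ereal (d + 1 / real (Suc n))) \<longlonglongrightarrow> ereal d" by (simp del: of_nat_Suc)
    show "\<forall>\<^sub>F n in sequentially. F u \<le> ereal (d + 1 / real (Suc n))" using u by simp
  qed simp
  with d_le show ?thesis by (meson order_trans)
qed

lemma norm_midpoint_squared:
  fixes x y w :: "'a::real_inner"
  shows "(norm ((1 / 2) *\<^sub>R (x + y) - w))\<^sup>2
    = ((norm (x - w))\<^sup>2 + (norm (y - w))\<^sup>2) / 2 - (norm (x - y))\<^sup>2 / 4"
  unfolding power2_norm_eq_inner by (simp add: algebra_simps inner_commute add_divide_distrib diff_divide_distrib)


section \<open>Lower semicontinuous convex functions\<close>

lemma lsc_fun_iff_eventually: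
  fixes h :: "'a::topological_space \<Rightarrow> ereal"
  assumes "\<And>x. h x \<noteq> -\<infinity>"
  shows "lsc_fun h \<longleftrightarrow> (\<forall>x a. ereal a < h x \<longrightarrow> (\<forall>\<^sub>F v in nhds x. ereal a < h v))"
proof (intro iffI allI impI)
  fix x a
  assume "lsc_fun h" and a: "ereal a < h x"
  then have "ereal a < Liminf (at x) h" unfolding lsc_fun_def by (meson less_le_trans)
  then have "\<forall>\<^sub>F v in at x. ereal a < h v" by (rule less_LiminfD)
  with a show "\<forall>\<^sub>F v in nhds x. ereal a < h v"
    by (auto simp: eventually_at_filter elim!: eventually_mono)
next
  assume *: "\<forall>x a. ereal a < h x \<longrightarrow> (\<forall>\<^sub>F v in nhds x. ereal a < h v)"
  show "lsc_fun h"
    unfolding lsc_fun_def le_Liminf_iff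
  proof (intro allI impI)
    fix x y
    assume y: "y < h x"
    show "\<forall>\<^sub>F v in at x. y < h v"
    proof (cases y)
      case (real a)
      with * y have "\<forall>\<^sub>F v in nhds x. y < h v" by blast
      then show ?thesis by (auto simp: eventually_at_filter elim: eventually_mono)
    qed (use y assms in auto)
  qed
qed

lemma lsc_fun_add_continuous:
  fixes h :: "'a::t2_space \<Rightarrow> ereal" and q :: "'a \<Rightarrow> real"
  assumes h: "\<And>x. h x \<noteq> -\<infinity>" "lsc_fun h" and q: "continuous_on UNIV q"
  shows "lsc_fun (\<lambda>x. h x + ereal (q x))"
proof (subst lsc_fun_iff_eventually, goal_cases)
  case (1 x)
  then show ?case using h(1)[of x] by (cases "h x") auto
next
  case 2
  show ?case
  proof (intro allI impI)
    fix x a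
    assume "ereal a < h x + ereal (q x)"
    then have "ereal (a - q x) < h x" using h(1)[of x] by (cases "h x") auto
    then obtain b where b: "ereal (a - q x) < ereal b" "ereal b < h x"
      using ereal_dense2 by blast
    have "\<forall>\<^sub>F v in nhds x. ereal b < h v"
      using h b(2) by (simp add: lsc_fun_iff_eventually)
    moreover have "(q \<longlongrightarrow> q x) (nhds x)"
      using q by (simp add: continuous_on_eq_continuous_at isCont_def tendsto_at_iff_tendsto_nhds)
    then have "\<forall>\<^sub>F v in nhds x. a - b < q v"
      using b(1) by (intro order_tendstoD(1)) auto
    ultimately show "\<forall>\<^sub>F v in nhds x. ereal a < h v + ereal (q v)"
    proof eventually_elim
      case (elim v)
      then show ?case using h(1)[of v] by (cases "h v") auto
    qed
  qed
qed

lemma lsc_fun_scale: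
  fixes h :: "'a::topological_space \<Rightarrow> ereal"
  assumes h: "\<And>x. h x \<noteq> -\<infinity>" "lsc_fun h" and c: "c > 0"
  shows "lsc_fun (\<lambda>x. ereal c * h x)"
proof (subst lsc_fun_iff_eventually, goal_cases)
  case (1 x)
  then show ?case using h(1)[of x] c by (cases "h x") auto
next
  case 2
  have scale: "ereal a < ereal c * h v \<longleftrightarrow> ereal (a / c) < h v" for a v
    using h(1)[of v] c by (cases "h v") (auto simp: field_simps)
  show ?case using h unfolding scale by (simp add: lsc_fun_iff_eventually)
qed

lemma lsc_fun_closed_sublevel:
  fixes h :: "'a::topological_space \<Rightarrow> ereal"
  assumes "\<And>x. h x \<noteq> -\<infinity>" "lsc_fun h"
  shows "closed {x. h x \<le> ereal a}"
proof -
  have "\<forall>x. ereal a < h x \<longrightarrow> (\<forall>\<^sub>F v in nhds x. ereal a < h v)"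
    using assms by (simp add: lsc_fun_iff_eventually)
  then have "open {x. ereal a < h x}" 
    by (subst open_subopen) (simp add: eventually_nhds subset_eq)
  moreover have "{x. h x \<le> ereal a} = - {x. ereal a < h x}" by auto
  ultimately show ?thesis by (simp add: closed_def)
qed

lemma proper_fun_scale_add:
  assumes "proper_fun h" "c > 0"
  shows "proper_fun (\<lambda>x. ereal c * (h x + ereal (q x)))"
proof -
  have "ereal c * (h x + ereal (q x)) = -\<infinity> \<longleftrightarrow> h x = -\<infinity>"
    "ereal c * (h x + ereal (q x)) = \<infinity> \<longleftrightarrow> h x = \<infinity>" for x
    using \<open>c > 0\<close> by (cases "h x"; simp)+
  then show ?thesis using assms by (simp add: proper_fun_def)
qed

lemma lsc_fun_scale_add:
  fixes h :: "'a::t2_space \<Rightarrow> ereal"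
  assumes h: "proper_fun h" "lsc_fun h" and c: "c > 0" and q: "continuous_on UNIV q"
  shows "lsc_fun (\<lambda>x. ereal c * (h x + ereal (q x)))"
proof -
  have not_MInf: "h x \<noteq> -\<infinity>" for x using h(1) by (simp add: proper_fun_def)
  show ?thesis
  proof (intro lsc_fun_scale c lsc_fun_add_continuous not_MInf h q)
    show "h x + ereal (q x) \<noteq> -\<infinity>" for x using not_MInf[of x] by (cases "h x") auto
  qed
qed

lemma convex_fun_realD:
  assumes "convex_fun h" "0 < l" "l < 1" "h x \<le> ereal a" "h y \<le> ereal b"
  shows "h ((1 - l) *\<^sub>R x + l *\<^sub>R y) \<le> ereal ((1 - l) * a + l * b)"
proof -
  have "h ((1 - l) *\<^sub>R x + l *\<^sub>R y) \<le> ereal (1 - l) * h x + ereal l * h y"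
    using assms unfolding convex_fun_def by auto
  also have "\<dots> \<le> ereal (1 - l) * ereal a + ereal l * ereal b"
    using assms by (intro add_mono ereal_mult_left_mono) auto
  finally show ?thesis by simp
qed

lemma convex_fun_scale:
  assumes "convex_fun h" "c > 0" and not_MInf: "\<And>x. h x \<noteq> -\<infinity>"
  shows "convex_fun (\<lambda>x. ereal c * h x)"
  unfolding convex_fun_def
proof (intro allI ballI)
  fix x y and l :: real
  assume l: "l \<in> {0<..<1}"
  then have "h ((1 - l) *\<^sub>R x + l *\<^sub>R y) \<le> ereal (1 - l) * h x + ereal l * h y"
    using assms(1) by (auto simp: convex_fun_def)
  then have "ereal c * h ((1 - l) *\<^sub>R x + l *\<^sub>R y) \<le> ereal c * (ereal (1 - l) * h x + ereal l * h y)"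
    using \<open>c > 0\<close> by (intro ereal_mult_left_mono) auto
  also have "\<dots> = ereal (1 - l) * (ereal c * h x) + ereal l * (ereal c * h y)"
    using l \<open>c > 0\<close> not_MInf[of x] not_MInf[of y]
    by (cases "h x"; cases "h y") (auto simp: algebra_simps)
  finally show "ereal c * h ((1 - l) *\<^sub>R x + l *\<^sub>R y)
      \<le> ereal (1 - l) * (ereal c * h x) + ereal l * (ereal c * h y)" .
qed

text \<open>
  The norm of a real inner product space satisfies the strong convexity inequality of
  \<open>c/2 \<parallel>\<cdot>\<parallel>\<^sup>2\<close> with equality, so subtracting this function leaves exactly convexity.
\<close>
lemma strongly_convex_minus_square_convex:
  fixes h :: "'a::real_inner \<Rightarrow> ereal"
  assumes "strongly_convex_fun c h" and not_MInf: "\<And>x. h x \<noteq> -\<infinity>"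
  shows "convex_fun (\<lambda>x. h x + ereal (- (c / 2 * (norm x)\<^sup>2)))"
  unfolding convex_fun_def
proof (intro allI ballI)
  fix x y :: 'a and l :: real
  assume l: "l \<in> {0<..<1}"
  let ?v = "(1 - l) *\<^sub>R x + l *\<^sub>R y"
  define p q s d where "p = c / 2 * (norm x)\<^sup>2" and "q = c / 2 * (norm y)\<^sup>2"
    and "s = c / 2 * (norm ?v)\<^sup>2" and "d = c * l * (1 - l) / 2 * (norm (x - y))\<^sup>2"
  have "h ?v \<le> ereal (1 - l) * h x + ereal l * h y - ereal d"
    using assms(1) l by (auto simp: strongly_convex_fun_def d_def)
  moreover have "(norm ?v)\<^sup>2
      = (1 - l) * (norm x)\<^sup>2 + l * (norm y)\<^sup>2 - l * (1 - l) * (norm (x - y))\<^sup>2"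
    unfolding power2_norm_eq_inner by (simp add: inner_simps inner_commute algebra_simps)
  then have "s = (1 - l) * p + l * q - d"
    unfolding p_def q_def s_def d_def by (simp only:) (simp add: field_simps)
  ultimately have "h ?v + ereal (- s) \<le> ereal (1 - l) * (h x + ereal (- p)) + ereal l * (h y + ereal (- q))"
    using l not_MInf[of x] not_MInf[of y] not_MInf[of ?v]
    by (cases "h x"; cases "h y"; cases "h ?v") (simp_all add: algebra_simps)
  then show "h ?v + ereal (- (c / 2 * (norm ?v)\<^sup>2))
      \<le> ereal (1 - l) * (h x + ereal (- (c / 2 * (norm x)\<^sup>2)))
        + ereal l * (h y + ereal (- (c / 2 * (norm y)\<^sup>2)))"
    unfolding p_def q_def s_def .
qed

text \<open>
  Lower semicontinuity bounds \<open>h\<close> from below on a small ball around a point \<open>x0\<close> of its domain; a far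
  point \<open>y\<close> is compared with the point of the ball on the segment from \<open>x0\<close> to \<open>y\<close>, and convexity then
  limits the descent of \<open>h\<close> to a linear one. This replaces an affine minorant obtained from separation
  and is enough to bound the proximal objective from below.
\<close>
lemma convex_lsc_linear_minorant:
  fixes h :: "'a::real_inner \<Rightarrow> ereal"
  assumes h: "proper_fun h" "lsc_fun h" "convex_fun h"
  obtains x0 a0 K where "h x0 = ereal a0" "K \<ge> 0" "\<And>y. ereal (a0 - 1 - K * norm (y - x0)) \<le> h y"
proof -
  have not_MInf: "h x \<noteq> -\<infinity>" for x using h(1) by (simp add: proper_fun_def)
  obtain x0 where "h x0 \<noteq> \<infinity>" using h(1) by (auto simp: proper_fun_def)
  with not_MInf[of x0] obtain a0 where a0: "h x0 = ereal a0" by (cases "h x0") auto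
  have "\<forall>\<^sub>F v in nhds x0. ereal (a0 - 1) < h v"
    using h(2) not_MInf a0 by (auto simp: lsc_fun_iff_eventually)
  then obtain e where e: "e > 0" "\<And>v. dist v x0 < e \<Longrightarrow> ereal (a0 - 1) < h v"
    unfolding eventually_nhds_metric by auto
  have "ereal (a0 - 1 - 2 / e * norm (y - x0)) \<le> h y" for y
  proof (cases "dist y x0 < e")
    case True
    have "a0 - 1 - 2 / e * norm (y - x0) \<le> a0 - 1" using e(1) by simp
    then have "ereal (a0 - 1 - 2 / e * norm (y - x0)) \<le> ereal (a0 - 1)" by simp
    also have "\<dots> \<le> h y" using e(2)[OF True] by simp
    finally show ?thesis .
  next
    case False
    \<comment> \<open>The point at parameter \<open>t\<close> of the segment from \<open>x0\<close> to \<open>y\<close> has distance \<open>e/2\<close> from \<open>x0\<close>.\<close>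
    define t where "t = e / (2 * norm (y - x0))"
    have n: "norm (y - x0) \<ge> e" using False by (simp add: dist_norm)
    with e(1) have npos: "norm (y - x0) > 0" by linarith
    have t: "0 < t" "t < 1" using e(1) n npos by (simp_all add: t_def field_simps)
    have "(1 - t) *\<^sub>R x0 + t *\<^sub>R y - x0 = t *\<^sub>R (y - x0)" by (simp add: algebra_simps)
    then have "dist ((1 - t) *\<^sub>R x0 + t *\<^sub>R y) x0 = e / 2"
      using npos e(1) t(1) by (simp add: dist_norm) (simp add: t_def)
    then have low: "ereal (a0 - 1) < h ((1 - t) *\<^sub>R x0 + t *\<^sub>R y)" using e by simp
    show ?thesis
    proof (cases "h y")
      case (real b)
      have "h ((1 - t) *\<^sub>R x0 + t *\<^sub>R y) \<le> ereal ((1 - t) * a0 + t * b)"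
        using convex_fun_realD[OF h(3) t, of x0 a0 y b] a0 real by simp
      with low have "ereal (a0 - 1) < ereal ((1 - t) * a0 + t * b)" by (rule less_le_trans)
      then have "t * (a0 - b) < 1" by (simp add: algebra_simps)
      then have "a0 - b < 2 / e * norm (y - x0)"
        using t e(1) npos by (simp add: t_def field_simps)
      then show ?thesis using real by simp
    qed (use not_MInf in auto)
  qed
  then show thesis using that[OF a0, of "2 / e"] e(1) by simp
qed


section \<open>Monotone operators and their resolvents\<close>

text \<open>
  The modulus \<open>m = 0\<close> gives ordinary monotonicity, so that one notion covers both.
\<close>
definition strongly_monotone :: "real \<Rightarrow> ('a::real_inner \<Rightarrow> 'a set) \<Rightarrow> bool" where
  "strongly_monotone m M \<longleftrightarrow>
     (\<forall>x y. \<forall>u\<in>M x. \<forall>v\<in>M y. m * (norm (x - y))\<^sup>2 \<le> inner (u - v) (x - y))"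

lemma strongly_monotone_mono:
  assumes "strongly_monotone m M" "m' \<le> m"
  shows "strongly_monotone m' M"
  using assms unfolding strongly_monotone_def
  by (meson mult_right_mono order_trans zero_le_power2)

lemma resolvent_set_unique:
  assumes M: "strongly_monotone 0 M" and r: "r > 0"
    and u: "u \<in> resolvent_set r M p" and v: "v \<in> resolvent_set r M p"
  shows "u = v"
proof -
  obtain a where a: "a \<in> M u" "p = u + r *\<^sub>R a" using u unfolding resolvent_set_def by blast
  obtain b where b: "b \<in> M v" "p = v + r *\<^sub>R b" using v unfolding resolvent_set_def by blast
  from a(2) b(2) have "u - v = - (r *\<^sub>R (a - b))" by (simp add: algebra_simps)
  then have "inner (u - v) (u - v) = - (r * inner (a - b) (u - v))"
    by (metis inner_minus_left inner_scaleR_left)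
  moreover have "inner (a - b) (u - v) \<ge> 0"
    using M a b unfolding strongly_monotone_def by fastforce
  ultimately have "inner (u - v) (u - v) \<le> 0" using r by simp
  then show ?thesis by (metis eq_iff_diff_eq_0 inner_eq_zero_iff inner_ge_zero order_antisym)
qed

lemma resolvent_eqI:
  assumes "strongly_monotone 0 M" "r > 0" "u \<in> resolvent_set r M p"
  shows "resolvent r M p = u"
proof -
  have "resolvent_set r M p = {u}" using resolvent_set_unique[OF assms(1,2)] assms(3) by blast
  then show ?thesis by (simp add: resolvent_def)
qed

lemma resolvent_residual:
  assumes "u \<in> resolvent_set r M p" "r > 0"
  shows "(1 / r) *\<^sub>R (p - u) \<in> M u"
  using assms by (auto simp: resolvent_set_def)

text \<open>
  With \<open>p = u + ra\<close> and \<open>q = v + rb\<close> the reflections are \<open>u - ra\<close> and \<open>v - rb\<close>; the squared distances before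
  and after differ by \<open>4r\<langle>a - b, u - v\<rangle> \<ge> 0\<close>.
\<close>
lemma reflected_resolvent_nonexpansive:
  fixes M :: "'a::real_inner \<Rightarrow> 'a set"
  assumes M: "strongly_monotone 0 M" and r: "r > 0" and total: "\<And>p. resolvent_set r M p \<noteq> {}"
  shows "norm (reflected_resolvent r M p - reflected_resolvent r M q) \<le> norm (p - q)"
proof -
  obtain u v where u: "u \<in> resolvent_set r M p" and v: "v \<in> resolvent_set r M q"
    using total by blast
  obtain a b where ab: "a \<in> M u" "p = u + r *\<^sub>R a" "b \<in> M v" "q = v + r *\<^sub>R b"
    using u v by (auto simp: resolvent_set_def)
  have R: "reflected_resolvent r M p = u - r *\<^sub>R a" "reflected_resolvent r M q = v - r *\<^sub>R b"
    unfolding reflected_resolvent_def using resolvent_eqI[OF M r u] resolvent_eqI[OF M r v] ab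
    by (simp_all add: scaleR_2)
  have "0 \<le> inner (a - b) (u - v)" using M ab unfolding strongly_monotone_def by fastforce
  then have "0 \<le> 4 * r * inner (a - b) (u - v)" using r by simp
  also have "\<dots> = (norm (p - q))\<^sup>2 - (norm (u - r *\<^sub>R a - (v - r *\<^sub>R b)))\<^sup>2"
    unfolding ab(2,4) power2_norm_eq_inner by (simp add: algebra_simps inner_commute)
  finally have "(norm (u - r *\<^sub>R a - (v - r *\<^sub>R b)))\<^sup>2 \<le> (norm (p - q))\<^sup>2" by linarith
  then show ?thesis unfolding R by (rule power2_le_imp_le) (rule norm_ge_zero)
qed

text \<open>
  At a fixed point \<open>p\<close> both resolvents take the same value \<open>x\<close>, and their residuals are opposite elements
  of \<open>A x\<close> and \<open>B x\<close>; conversely \<open>x + ra\<close> is fixed.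
\<close>
lemma reflected_resolvent_comp_fixpoint_iff:
  fixes A B :: "'a::real_inner \<Rightarrow> 'a set"
  assumes A: "strongly_monotone 0 A" and B: "strongly_monotone 0 B" and r: "r > 0"
    and totalA: "\<And>p. resolvent_set r A p \<noteq> {}" and totalB: "\<And>p. resolvent_set r B p \<noteq> {}"
  shows "(\<exists>p. (reflected_resolvent r B \<circ> reflected_resolvent r A) p = p)
    \<longleftrightarrow> (\<exists>x. \<exists>a\<in>A x. - a \<in> B x)"
proof
  assume "\<exists>p. (reflected_resolvent r B \<circ> reflected_resolvent r A) p = p"
  then obtain p where p: "reflected_resolvent r B (reflected_resolvent r A p) = p" by auto
  obtain x where x: "x \<in> resolvent_set r A p" using totalA by blast
  define q where "q = 2 *\<^sub>R x - p"
  have RA: "reflected_resolvent r A p = q"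
    using resolvent_eqI[OF A r x] by (simp add: reflected_resolvent_def q_def)
  obtain v where v: "v \<in> resolvent_set r B q" using totalB by blast
  have "reflected_resolvent r B q = p" using p RA by simp
  then have "2 *\<^sub>R v - q = p"
    using resolvent_eqI[OF B r v] by (simp add: reflected_resolvent_def)
  then have "2 *\<^sub>R v = 2 *\<^sub>R x" by (simp add: q_def algebra_simps)
  then have "v = x" by simp
  have "(1 / r) *\<^sub>R (p - x) \<in> A x" using resolvent_residual[OF x r] .
  moreover have "(1 / r) *\<^sub>R (q - x) \<in> B x" using resolvent_residual[OF v r] \<open>v = x\<close> by simp
  moreover have "(1 / r) *\<^sub>R (q - x) = - ((1 / r) *\<^sub>R (p - x))"
    unfolding scaleR_minus_right[symmetric] by (simp add: q_def scaleR_2)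
  ultimately show "\<exists>x. \<exists>a\<in>A x. - a \<in> B x" by metis
next
  assume "\<exists>x. \<exists>a\<in>A x. - a \<in> B x"
  then obtain x a where a: "a \<in> A x" "- a \<in> B x" by blast
  have "x \<in> resolvent_set r A (x + r *\<^sub>R a)" using a unfolding resolvent_set_def by blast
  then have "reflected_resolvent r A (x + r *\<^sub>R a) = x - r *\<^sub>R a"
    using resolvent_eqI[OF A r] by (simp add: reflected_resolvent_def scaleR_2)
  moreover have "x \<in> resolvent_set r B (x - r *\<^sub>R a)"
    using a unfolding resolvent_set_def by force
  then have "reflected_resolvent r B (x - r *\<^sub>R a) = x + r *\<^sub>R a"
    using resolvent_eqI[OF B r] by (simp add: reflected_resolvent_def scaleR_2)
  ultimately show "\<exists>p. (reflected_resolvent r B \<circ> reflected_resolvent r A) p = p"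
    by (metis comp_apply)
qed


section \<open>Subdifferentials and proximal maps\<close>

lemma subdiff_finite:
  assumes "proper_fun h" "u \<in> subdiff h x"
  obtains a where "h x = ereal a"
proof -
  obtain y where "h y \<noteq> \<infinity>" using assms(1) by (auto simp: proper_fun_def)
  moreover have "h x + ereal (inner u (y - x)) \<le> h y" using assms(2) by (simp add: subdiff_def)
  ultimately have "h x \<noteq> \<infinity>" by auto
  moreover have "h x \<noteq> -\<infinity>" using assms(1) by (simp add: proper_fun_def)
  ultimately show thesis using that by (cases "h x") auto
qed

lemma subdiff_monotone:
  fixes h :: "'a::real_inner \<Rightarrow> ereal"
  assumes "proper_fun h"
  shows "strongly_monotone 0 (subdiff h)"
  unfolding strongly_monotone_def
proof (intro allI ballI)
  fix x y u v
  assume u: "u \<in> subdiff h x" and v: "v \<in> subdiff h y"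
  obtain a b where ab: "h x = ereal a" "h y = ereal b"
    using subdiff_finite[OF assms u] subdiff_finite[OF assms v] by metis
  have "h x + ereal (inner u (y - x)) \<le> h y" "h y + ereal (inner v (x - y)) \<le> h x"
    using u v by (auto simp: subdiff_def)
  then show "0 * (norm (x - y))\<^sup>2 \<le> inner (u - v) (x - y)"
    by (simp add: ab inner_diff)
qed

lemma prox_objective_has_minimizer:
  fixes h :: "'a::{real_inner, complete_space} \<Rightarrow> ereal"
  assumes h: "proper_fun h" "lsc_fun h" "convex_fun h" and t: "t > 0"
  shows "\<exists>u. \<forall>y. h u + ereal (1 / (2 * t) * (norm (u - w))\<^sup>2)
               \<le> h y + ereal (1 / (2 * t) * (norm (y - w))\<^sup>2)"
proof -
  have not_MInf: "h x \<noteq> -\<infinity>" for x using h(1) by (simp add: proper_fun_def)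
  obtain x0 a0 K where x0: "h x0 = ereal a0" and K: "K \<ge> 0"
    and minorant: "\<And>y. ereal (a0 - 1 - K * norm (y - x0)) \<le> h y"
    using convex_lsc_linear_minorant[OF h] by blast
  let ?F = "\<lambda>y. h y + ereal (1 / (2 * t) * (norm (y - w))\<^sup>2)"
  show ?thesis
  \<comment> \<open>The lower bound comes from \<open>K d \<le> K\<^sup>2 t / 2 + d\<^sup>2 / (2t)\<close> with \<open>d = \<parallel>y - w\<parallel>\<close>.\<close>
  proof (rule strongly_convex_minimizer_exists[where F = ?F and c = "1 / (8 * t)"
        and m = "a0 - 1 - K * norm (w - x0) - K\<^sup>2 * t / 2" and ?x0.0 = x0])
    show "1 / (8 * t) > 0" using t by simp
    show "?F x0 \<noteq> \<infinity>" using x0 by simp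
    show "closed {x. ?F x \<le> ereal a}" for a
    proof (rule lsc_fun_closed_sublevel)
      show "?F x \<noteq> -\<infinity>" for x using not_MInf[of x] by (cases "h x") auto
      show "lsc_fun ?F"
        by (intro lsc_fun_add_continuous not_MInf h continuous_intros)
    qed
    show "ereal (a0 - 1 - K * norm (w - x0) - K\<^sup>2 * t / 2) \<le> ?F y" for y
    proof -
      have "norm (y - x0) \<le> norm (y - w) + norm (w - x0)"
        using norm_triangle_ineq[of "y - w" "w - x0"] by simp
      then have "K * norm (y - x0) \<le> K * norm (y - w) + K * norm (w - x0)"
        using mult_left_mono[OF _ K] by (fastforce simp: distrib_left)
      moreover have "K * norm (y - w) \<le> K\<^sup>2 * t / 2 + 1 / (2 * t) * (norm (y - w))\<^sup>2"
      proof -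
        have "0 \<le> (K * t - norm (y - w))\<^sup>2 / (2 * t)" using t by simp
        also have "\<dots> = K\<^sup>2 * t / 2 + 1 / (2 * t) * (norm (y - w))\<^sup>2 - K * norm (y - w)"
          using t by (simp add: field_simps power2_eq_square)
        finally show ?thesis by simp
      qed
      ultimately have "a0 - 1 - K * norm (w - x0) - K\<^sup>2 * t / 2
          \<le> a0 - 1 - K * norm (y - x0) + 1 / (2 * t) * (norm (y - w))\<^sup>2" by linarith
      with minorant[of y] show ?thesis by (cases "h y") auto
    qed
    fix x y a b
    assume "?F x \<le> ereal a" "?F y \<le> ereal b"
    then obtain p q where p: "h x = ereal p" "p + 1 / (2 * t) * (norm (x - w))\<^sup>2 \<le> a"
      and q: "h y = ereal q" "q + 1 / (2 * t) * (norm (y - w))\<^sup>2 \<le> b"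
      using not_MInf[of x] not_MInf[of y] by (cases "h x"; cases "h y") auto
    have mid: "(1 / 2) *\<^sub>R (x + y) = (1 - 1 / 2) *\<^sub>R x + (1 / 2) *\<^sub>R y" by (simp add: scaleR_add_right)
    have "h ((1 / 2) *\<^sub>R (x + y)) \<le> ereal ((1 - 1 / 2) * p + 1 / 2 * q)"
      unfolding mid by (rule convex_fun_realD) (use h p q in auto)
    moreover have "1 / (2 * t) * (norm ((1 / 2) *\<^sub>R (x + y) - w))\<^sup>2
       = (1 / (2 * t) * (norm (x - w))\<^sup>2 + 1 / (2 * t) * (norm (y - w))\<^sup>2) / 2
          - 1 / (8 * t) * (norm (x - y))\<^sup>2"
      unfolding norm_midpoint_squared using t by (simp add: field_simps)
    ultimately show "?F ((1 / 2) *\<^sub>R (x + y)) \<le> ereal ((a + b) / 2 - 1 / (8 * t) * (norm (x - y))\<^sup>2)"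
      using p(2) q(2) by (cases "h ((1 / 2) *\<^sub>R (x + y))") (auto simp: field_simps)
  qed
qed

text \<open>
  Minimality is tested along the segment from \<open>u\<close> to \<open>y\<close>: convexity bounds \<open>h\<close> on it linearly, the
  quadratic term contributes its derivative plus a term of second order, and letting the
  segment parameter \<open>l\<close> tend to \<open>0\<close> leaves the subgradient inequality.
\<close>
lemma prox_minimizer_subgradient:
  fixes h :: "'a::real_inner \<Rightarrow> ereal"
  assumes h: "proper_fun h" "convex_fun h" and t: "t > 0"
    and min: "\<And>y. h u + ereal (1 / (2 * t) * (norm (u - w))\<^sup>2)
               \<le> h y + ereal (1 / (2 * t) * (norm (y - w))\<^sup>2)"
  shows "(1 / t) *\<^sub>R (w - u) \<in> subdiff h u"
proof -
  have not_MInf: "h x \<noteq> -\<infinity>" for x using h(1) by (simp add: proper_fun_def)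
  obtain x0 where "h x0 \<noteq> \<infinity>" using h(1) by (auto simp: proper_fun_def)
  with min[of x0] not_MInf[of u] obtain a where a: "h u = ereal a"
    by (cases "h u"; cases "h x0") auto
  have "a + inner ((1 / t) *\<^sub>R (w - u)) (y - u) \<le> b" if b: "h y = ereal b" for y b
  proof -
    have "t * (a - b) + inner (w - u) (y - u) \<le> l / 2 * (norm (y - u))\<^sup>2"
      if l: "0 < l" "l < 1" for l
    proof -
      let ?v = "(1 - l) *\<^sub>R u + l *\<^sub>R y"
      have "h ?v \<le> ereal ((1 - l) * a + l * b)"
        by (rule convex_fun_realD) (use h l a b in auto)
      with min[of ?v] a have "a + 1 / (2 * t) * (norm (u - w))\<^sup>2
          \<le> (1 - l) * a + l * b + 1 / (2 * t) * (norm (?v - w))\<^sup>2"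
        by (cases "h ?v") auto
      moreover have "(norm (?v - w))\<^sup>2
          = (norm (u - w))\<^sup>2 - 2 * l * inner (w - u) (y - u) + l\<^sup>2 * (norm (y - u))\<^sup>2"
        unfolding power2_norm_eq_inner
        by (simp add: algebra_simps inner_commute power2_eq_square)
      ultimately have "a + 1 / (2 * t) * (norm (u - w))\<^sup>2 \<le> (1 - l) * a + l * b + 1 / (2 * t)
          * ((norm (u - w))\<^sup>2 - 2 * l * inner (w - u) (y - u) + l\<^sup>2 * (norm (y - u))\<^sup>2)"
        by simp
      then have "l * (a - b) + l * (1 / t) * inner (w - u) (y - u) \<le> l\<^sup>2 * (1 / (2 * t)) * (norm (y - u))\<^sup>2"
        by (simp add: algebra_simps)
      then have "t * (l * (a - b) + l * (1 / t) * inner (w - u) (y - u))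
          \<le> t * (l\<^sup>2 * (1 / (2 * t)) * (norm (y - u))\<^sup>2)"
        using t by (intro mult_left_mono) auto
      moreover have "t * (l * (a - b) + l * (1 / t) * inner (w - u) (y - u))
          = l * (t * (a - b) + inner (w - u) (y - u))"
        using t by (simp add: field_simps)
      moreover have "t * (l\<^sup>2 * (1 / (2 * t)) * (norm (y - u))\<^sup>2) = l * (l / 2 * (norm (y - u))\<^sup>2)"
        using t by (simp add: field_simps power2_eq_square)
      ultimately have "l * (t * (a - b) + inner (w - u) (y - u)) \<le> l * (l / 2 * (norm (y - u))\<^sup>2)"
        by simp
      then show ?thesis using l(1) by simp
    qed
    then have "\<forall>\<^sub>F l in at_right 0.
        t * (a - b) + inner (w - u) (y - u) \<le> l / 2 * (norm (y - u))\<^sup>2"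
      by (auto simp: eventually_at_right[OF zero_less_one] intro: exI[of _ 1])
    moreover have "((\<lambda>l. l / 2 * (norm (y - u))\<^sup>2) \<longlongrightarrow> 0) (at_right 0)"
      by (auto intro!: tendsto_eq_intros)
    ultimately have "t * (a - b) + inner (w - u) (y - u) \<le> 0"
      by (intro tendsto_lowerbound) auto
    then show ?thesis unfolding inner_scaleR_left using t by (simp add: field_simps)
  qed
  then show ?thesis
    unfolding subdiff_def a using not_MInf by (auto, case_tac "h y") auto
qed

text \<open>
  This is the part of the maximal monotonicity of \<open>\<partial>h\<close> that matters below: the resolvent is defined
  on the whole space.
\<close>
lemma prox_in_resolvent_set:
  fixes h :: "'a::{real_inner, complete_space} \<Rightarrow> ereal"
  assumes h: "proper_fun h" "lsc_fun h" "convex_fun h" and t: "t > 0"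
  shows "prox t h w \<in> resolvent_set t (subdiff h) w"
proof -
  let ?F = "\<lambda>y. h y + ereal (1 / (2 * t) * (norm (y - w))\<^sup>2)"
  obtain u where "\<forall>y. ?F u \<le> ?F y" using prox_objective_has_minimizer[OF h t] by blast
  then have "is_arg_min ?F (\<lambda>_. True) u" by (simp add: is_arg_min_def not_less)
  then have "is_arg_min ?F (\<lambda>_. True) (prox t h w)"
    unfolding prox_def arg_min_def by (rule someI)
  then have "?F (prox t h w) \<le> ?F y" for y by (simp add: is_arg_min_def not_less)
  then have "(1 / t) *\<^sub>R (w - prox t h w) \<in> subdiff h (prox t h w)"
    by (rule prox_minimizer_subgradient[OF h(1,3) t])
  then show ?thesis unfolding resolvent_set_def using t by (force intro!: bexI)
qed

text \<open>
  If \<open>u = -(a + b)\<close> with subgradients \<open>a\<close> of \<open>f\<close> and \<open>b\<close> of \<open>g\<close> at \<open>u\<close>, adding the subgradient inequalities to the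
  expansion of \<open>\<parallel>v\<parallel>\<^sup>2 / 2\<close> around \<open>u\<close> cancels all linear terms and leaves quadratic growth from \<open>u\<close>.
\<close>
lemma resolvent_at_zero_unique_minimizer:
  fixes f g F :: "'a::real_inner \<Rightarrow> ereal"
  assumes f: "proper_fun f" and g: "proper_fun g" and c: "c > 0"
    and F: "\<And>v. f v + g v + ereal ((norm v)\<^sup>2 / 2) = ereal c * F v"
    and u: "u \<in> resolvent_set 1 (\<lambda>u. subdiff f u + subdiff g u) 0"
  shows "is_arg_min F (\<lambda>_. True) v \<longleftrightarrow> v = u"
proof -
  obtain a b where a: "a \<in> subdiff f u" and b: "b \<in> subdiff g u" and "0 = u + (a + b)"
    using u by (auto simp: resolvent_set_def set_plus_def)
  then have ab: "u = - (a + b)" by (metis eq_neg_iff_add_eq_0)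
  obtain s t where st: "f u = ereal s" "g u = ereal t"
    using subdiff_finite[OF f a] subdiff_finite[OF g b] by metis
  define S where "S = s + t + (norm u)\<^sup>2 / 2"
  have Su: "ereal c * F u = ereal S" unfolding F[symmetric] st S_def by simp
  have growth: "ereal (S + (norm (v - u))\<^sup>2 / 2) \<le> ereal c * F v" for v
  proof -
    have "ereal (s + inner a (v - u)) \<le> f v" "ereal (t + inner b (v - u)) \<le> g v"
      using a b st by (auto simp: subdiff_def)
    then have "ereal (s + inner a (v - u)) + ereal (t + inner b (v - u)) + ereal ((norm v)\<^sup>2 / 2)
        \<le> f v + g v + ereal ((norm v)\<^sup>2 / 2)"
      by (intro add_mono order_refl)
    moreover have "inner a (v - u) + inner b (v - u) + (norm v)\<^sup>2 / 2
        = (norm u)\<^sup>2 / 2 + (norm (v - u))\<^sup>2 / 2"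
    proof -
      have "inner a (v - u) + inner b (v - u) = - inner u (v - u)"
        unfolding ab by (simp add: inner_simps)
      then show ?thesis unfolding power2_norm_eq_inner 
        by (simp add: inner_simps inner_commute add_divide_distrib diff_divide_distrib)
    qed
    ultimately show ?thesis unfolding F by (simp add: S_def algebra_simps)
  qed
  have cancel: "ereal c * F v \<le> ereal c * F w \<longleftrightarrow> F v \<le> F w" for v w
    using c by (simp add: ereal_mult_le_mult_iff)
  have "F u \<le> F v" for v
  proof -
    have "ereal c * F u \<le> ereal (S + (norm (v - u))\<^sup>2 / 2)" unfolding Su by simp
    also note growth
    finally show ?thesis unfolding cancel .
  qed
  moreover have "v = u" if "F v \<le> F u" for v
  proof -
    have "ereal (S + (norm (v - u))\<^sup>2 / 2) \<le> ereal S"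
      using growth[of v] that unfolding Su[symmetric] cancel[symmetric] by (rule order_trans)
    then show ?thesis by simp
  qed
  ultimately show ?thesis by (auto simp: is_arg_min_def not_less)
qed


section \<open>The transformed operator\<close>

lemma beta_op_strongly_monotone:
  fixes M :: "'a::real_inner \<Rightarrow> 'a set"
  assumes M: "strongly_monotone 0 M" and \<beta>: "0 < \<beta>" "\<beta> < 1"
  shows "strongly_monotone ((1 - \<beta>) / \<beta>) (beta_op \<beta> M)"
  unfolding strongly_monotone_def beta_op_def
proof clarify
  fix x y u v
  assume "u \<in> M ((1 / \<beta>) *\<^sub>R x)" "v \<in> M ((1 / \<beta>) *\<^sub>R y)"
  then have "0 \<le> inner (u - v) ((1 / \<beta>) *\<^sub>R x - (1 / \<beta>) *\<^sub>R y)"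
    using M unfolding strongly_monotone_def by fastforce
  also have "\<dots> = inner (u - v) (x - y) / \<beta>"
    by (simp add: inner_diff_right diff_divide_distrib)
  finally have "0 \<le> 2 * (1 - \<beta>) * inner (u - v) (x - y)"
    using \<beta> by (simp add: zero_le_divide_iff)
  also have "\<dots> = inner ((2 * (1 - \<beta>)) *\<^sub>R u + ((1 - \<beta>) / \<beta>) *\<^sub>R x
      - ((2 * (1 - \<beta>)) *\<^sub>R v + ((1 - \<beta>) / \<beta>) *\<^sub>R y)) (x - y) - (1 - \<beta>) / \<beta> * (norm (x - y))\<^sup>2"
    unfolding power2_norm_eq_inner by (simp add: inner_diff_left inner_add_left algebra_simps)
  finally show "(1 - \<beta>) / \<beta> * (norm (x - y))\<^sup>2
      \<le> inner ((2 * (1 - \<beta>)) *\<^sub>R u + ((1 - \<beta>) / \<beta>) *\<^sub>R x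
        - ((2 * (1 - \<beta>)) *\<^sub>R v + ((1 - \<beta>) / \<beta>) *\<^sub>R y)) (x - y)" by simp
qed

text \<open>
  Multiplying the inclusion for \<open>u\<close> by \<open>\<beta> + r(1 - \<beta>)\<close> gives
  \<open>w = \<beta>u + r(2(1 - \<beta>)v + (1 - \<beta>)u)\<close> with \<open>v \<in> M u\<close>, and the bracket is an element of the transformed
  operator at \<open>\<beta>u\<close>. Through this identity the scaled proximal steps of the algorithm are resolvents.
\<close>
lemma resolvent_set_beta_op:
  assumes \<beta>: "0 < \<beta>" "\<beta> < 1" and r: "r > 0"
    and u: "u \<in> resolvent_set (2 * r * (1 - \<beta>) / (\<beta> + r * (1 - \<beta>))) M
               ((1 / (\<beta> + r * (1 - \<beta>))) *\<^sub>R w)"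
  shows "\<beta> *\<^sub>R u \<in> resolvent_set r (beta_op \<beta> M) w"
proof -
  define D where "D = \<beta> + r * (1 - \<beta>)"
  have D: "D > 0" using \<beta> r by (simp add: D_def add_pos_pos)
  obtain v where v: "v \<in> M u" and w: "(1 / D) *\<^sub>R w = u + (2 * r * (1 - \<beta>) / D) *\<^sub>R v"
    using u by (auto simp: resolvent_set_def D_def)
  have "w = D *\<^sub>R ((1 / D) *\<^sub>R w)" using D by simp
  also have "\<dots> = D *\<^sub>R u + (2 * r * (1 - \<beta>)) *\<^sub>R v" using D unfolding w by (simp add: scaleR_add_right)
  also have "\<dots> = \<beta> *\<^sub>R u + r *\<^sub>R ((2 * (1 - \<beta>)) *\<^sub>R v + ((1 - \<beta>) / \<beta>) *\<^sub>R (\<beta> *\<^sub>R u))"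
  proof -
    have "((1 - \<beta>) / \<beta>) *\<^sub>R (\<beta> *\<^sub>R u) = (1 - \<beta>) *\<^sub>R u" using \<beta> by simp
    then show ?thesis by (simp only: D_def) (simp add: scaleR_add_left scaleR_add_right mult.commute mult.left_commute)
  qed
  finally show ?thesis
    unfolding resolvent_set_def beta_op_def using v \<beta> by auto
qed

lemma prox_in_resolvent_set_beta_op:
  fixes h :: "'a::{real_inner, complete_space} \<Rightarrow> ereal"
  assumes h: "proper_fun h" "lsc_fun h" "convex_fun h"
    and \<beta>: "0 < \<beta>" "\<beta> < 1" and r: "r > 0"
  shows "\<beta> *\<^sub>R prox (2 * r * (1 - \<beta>) / (\<beta> + r * (1 - \<beta>))) h ((1 / (\<beta> + r * (1 - \<beta>))) *\<^sub>R w)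
    \<in> resolvent_set r (beta_op \<beta> (subdiff h)) w"
  by (intro resolvent_set_beta_op prox_in_resolvent_set h \<beta> r divide_pos_pos)
    (use \<beta> r in \<open>auto intro: add_pos_pos\<close>)

text \<open>
  The two linear terms \<open>((1 - \<beta>)/\<beta>) x\<close> add up to \<open>2(1 - \<beta>)\<close> times \<open>x/\<beta>\<close>; after cancelling \<open>2(1 - \<beta>)\<close> this is
  the identity term in \<open>0 \<in> u + A u + B u\<close>.
\<close>
lemma beta_op_common_zero_iff:
  fixes A B :: "'a::real_vector \<Rightarrow> 'a set"
  assumes \<beta>: "0 < \<beta>" "\<beta> < 1"
  shows "(\<exists>a\<in>beta_op \<beta> A x. - a \<in> beta_op \<beta> B x)
    \<longleftrightarrow> (1 / \<beta>) *\<^sub>R x \<in> resolvent_set 1 (\<lambda>u. A u + B u) 0"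
proof -
  have eq: "(2 * (1 - \<beta>)) *\<^sub>R b + ((1 - \<beta>) / \<beta>) *\<^sub>R x = - ((2 * (1 - \<beta>)) *\<^sub>R a + ((1 - \<beta>) / \<beta>) *\<^sub>R x)
      \<longleftrightarrow> 0 = (1 / \<beta>) *\<^sub>R x + (a + b)" for a b
  proof -
    have "(2 * (1 - \<beta>)) *\<^sub>R ((1 / \<beta>) *\<^sub>R x + (a + b))
        = ((2 * (1 - \<beta>)) *\<^sub>R b + ((1 - \<beta>) / \<beta>) *\<^sub>R x)
          + ((2 * (1 - \<beta>)) *\<^sub>R a + ((1 - \<beta>) / \<beta>) *\<^sub>R x)" (is "_ = ?b + ?a")
    proof -
      have "(2 * (1 - \<beta>)) *\<^sub>R ((1 / \<beta>) *\<^sub>R x) = ((1 - \<beta>) / \<beta>) *\<^sub>R x + ((1 - \<beta>) / \<beta>) *\<^sub>R x"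
        by (simp flip: scaleR_add_left)
      then show ?thesis unfolding scaleR_add_right by simp
    qed
    then have "?b = - ?a \<longleftrightarrow> (2 * (1 - \<beta>)) *\<^sub>R ((1 / \<beta>) *\<^sub>R x + (a + b)) = 0"
      by (simp only: eq_neg_iff_add_eq_0)
    also have "\<dots> \<longleftrightarrow> 0 = (1 / \<beta>) *\<^sub>R x + (a + b)"
      using \<beta> by (simp only: scaleR_eq_0_iff) auto
    finally show ?thesis .
  qed
  show ?thesis
  proof
    assume "\<exists>a\<in>beta_op \<beta> A x. - a \<in> beta_op \<beta> B x"
    then obtain a b where "a \<in> A ((1 / \<beta>) *\<^sub>R x)" "b \<in> B ((1 / \<beta>) *\<^sub>R x)"
      and "- ((2 * (1 - \<beta>)) *\<^sub>R a + ((1 - \<beta>) / \<beta>) *\<^sub>R x) = (2 * (1 - \<beta>)) *\<^sub>R b + ((1 - \<beta>) / \<beta>) *\<^sub>R x"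
      unfolding beta_op_def by blast
    then show "(1 / \<beta>) *\<^sub>R x \<in> resolvent_set 1 (\<lambda>u. A u + B u) 0"
      unfolding resolvent_set_def using eq[of b a] set_plus_intro by fastforce
  next
    assume "(1 / \<beta>) *\<^sub>R x \<in> resolvent_set 1 (\<lambda>u. A u + B u) 0"
    then obtain a b where ab: "a \<in> A ((1 / \<beta>) *\<^sub>R x)" "b \<in> B ((1 / \<beta>) *\<^sub>R x)"
      "0 = (1 / \<beta>) *\<^sub>R x + (a + b)"
      by (auto simp: resolvent_set_def elim!: set_plus_elim)
    show "\<exists>a\<in>beta_op \<beta> A x. - a \<in> beta_op \<beta> B x"
      unfolding beta_op_def using ab(1,2) eq[of b a, symmetric] ab(3) by force
  qed
qed


section \<open>Fixed points of nonexpansive maps\<close>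

text \<open>
  The asymptotic centre of the orbit, that is the minimizer \<open>u\<close> of
  \<open>F u = limsup \<parallel>T\<^sup>k p - u\<parallel>\<^sup>2\<close>, exists because \<open>F\<close> inherits the strong convexity of the
  squared norm. Since \<open>T\<close> shifts the orbit and is nonexpansive, \<open>F (T u) \<le> F u\<close>; strong convexity forces
  \<open>T u = u\<close>.
\<close>
lemma nonexpansive_bounded_orbit_fixpoint:
  fixes T :: "'a::{real_inner, complete_space} \<Rightarrow> 'a"
  assumes T: "\<And>x y. norm (T x - T y) \<le> norm (x - y)"
    and bdd: "bounded (range (\<lambda>k. (T ^^ k) p))"
  shows "\<exists>u. T u = u"
proof -
  define s where "s k = (T ^^ k) p" for k
  obtain K where K: "norm (s k) \<le> K" for k
    using bdd unfolding s_def bounded_iff by blast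
  define F where "F u = limsup (\<lambda>k. ereal ((norm (s k - u))\<^sup>2))" for u
  have F_le: "F u \<le> ereal a \<longleftrightarrow> (\<forall>e>0. \<forall>\<^sub>F k in sequentially. (norm (s k - u))\<^sup>2 < a + e)" for u a
  proof
    assume F: "F u \<le> ereal a"
    have "\<forall>\<^sub>F k in sequentially. ereal ((norm (s k - u))\<^sup>2) < ereal (a + e)" if "e > 0" for e
    proof -
      have "ereal a < ereal (a + e)" using that by simp
      with F show ?thesis unfolding F_def Limsup_le_iff by blast
    qed
    then show "\<forall>e>0. \<forall>\<^sub>F k in sequentially. (norm (s k - u))\<^sup>2 < a + e" by simp
  next
    assume *: "\<forall>e>0. \<forall>\<^sub>F k in sequentially. (norm (s k - u))\<^sup>2 < a + e"
    show "F u \<le> ereal a"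
      unfolding F_def Limsup_le_iff
    proof (intro allI impI)
      fix y assume y: "ereal a < y"
      show "\<forall>\<^sub>F k in sequentially. ereal ((norm (s k - u))\<^sup>2) < y"
      proof (cases y)
        case (real b)
        with y have "b - a > 0" by simp
        with * have "\<forall>\<^sub>F k in sequentially. (norm (s k - u))\<^sup>2 < a + (b - a)" by blast
        then show ?thesis using real by simp
      qed (use y in auto)
    qed
  qed
  have midpoint: "F ((1 / 2) *\<^sub>R (x + y)) \<le> ereal ((a + b) / 2 - 1 / 4 * (norm (x - y))\<^sup>2)"
    if "F x \<le> ereal a" "F y \<le> ereal b" for x y a b
    unfolding F_le
  proof (intro allI impI)
    fix e :: real assume "e > 0"
    then have "\<forall>\<^sub>F k in sequentially. (norm (s k - x))\<^sup>2 < a + e"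
      "\<forall>\<^sub>F k in sequentially. (norm (s k - y))\<^sup>2 < b + e" using that F_le by auto
    then show "\<forall>\<^sub>F k in sequentially. (norm (s k - (1 / 2) *\<^sub>R (x + y)))\<^sup>2
        < (a + b) / 2 - 1 / 4 * (norm (x - y))\<^sup>2 + e"
    proof eventually_elim
      case (elim k)
      then show ?case
        using norm_midpoint_squared[of x y "s k"] by (simp add: norm_minus_commute field_simps)
    qed
  qed
  have nonneg: "ereal 0 \<le> F x" for x
    unfolding F_def by (rule le_Limsup) auto
  have "F 0 \<le> ereal (K\<^sup>2)"
    unfolding F_def using K by (intro Limsup_bounded always_eventually) (simp add: power_mono)
  then have finite: "F 0 \<noteq> \<infinity>" by auto
  \<comment> \<open>On bounded sets \<open>\<parallel>s k - l\<parallel>\<^sup>2\<close> is Lipschitz in \<open>l\<close> uniformly in \<open>k\<close>, hence \<open>F\<close> is continuous.\<close>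
  have closed: "closed {x. F x \<le> ereal a}" for a
    unfolding closed_sequential_limits
  proof clarify
    fix v l
    assume v: "\<forall>n. v n \<in> {x. F x \<le> ereal a}" and lim: "v \<longlonglongrightarrow> l"
    show "F l \<le> ereal a"
      unfolding F_le
    proof (intro allI impI)
      fix e :: real assume "e > 0"
      have "(\<lambda>n. norm (v n - l) * (2 * K + norm (v n) + norm l)) \<longlonglongrightarrow> norm (l - l) * (2 * K + norm l + norm l)"
        by (intro tendsto_intros lim)
      then have "\<forall>\<^sub>F n in sequentially. norm (v n - l) * (2 * K + norm (v n) + norm l) < e / 2"
        using \<open>e > 0\<close> by (intro order_tendstoD(2)) auto
      then obtain n where n: "norm (v n - l) * (2 * K + norm (v n) + norm l) < e / 2"
        unfolding eventually_sequentially by blast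
      have "\<forall>\<^sub>F k in sequentially. (norm (s k - v n))\<^sup>2 < a + e / 2"
        using v \<open>e > 0\<close> F_le by simp
      then show "\<forall>\<^sub>F k in sequentially. (norm (s k - l))\<^sup>2 < a + e"
      proof eventually_elim
        case (elim k)
        have "(norm (s k - l))\<^sup>2 - (norm (s k - v n))\<^sup>2 = inner (v n - l) ((s k - l) + (s k - v n))"
          unfolding power2_norm_eq_inner by (simp add: algebra_simps inner_commute)
        also have "\<dots> \<le> norm (v n - l) * norm ((s k - l) + (s k - v n))" by (rule norm_cauchy_schwarz)
        also have "\<dots> \<le> norm (v n - l) * (2 * K + norm (v n) + norm l)"
          using K[of k] norm_triangle_ineq[of "s k - l" "s k - v n"]
            norm_triangle_ineq4[of "s k" l] norm_triangle_ineq4[of "s k" "v n"]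
          by (intro mult_left_mono) auto
        finally show ?case using n elim by linarith
      qed
    qed
  qed
  obtain u where u: "\<And>y. F u \<le> F y"
    using strongly_convex_minimizer_exists[of "1 / 4" F 0 0] midpoint nonneg finite closed by auto
  obtain a where a: "F u = ereal a"
    using nonneg[of u] u[of 0] finite by (cases "F u") auto
  have "F (T u) \<le> ereal a"
    unfolding F_le
  proof (intro allI impI)
    fix e :: real assume "e > 0"
    then have "\<forall>\<^sub>F k in sequentially. (norm (s k - u))\<^sup>2 < a + e" using F_le[of u a] a by simp
    then have "\<forall>\<^sub>F k in sequentially. (norm (s (Suc k) - T u))\<^sup>2 < a + e"
    proof eventually_elim
      case (elim k)
      have "norm (s (Suc k) - T u) \<le> norm (s k - u)" using T[of "s k" u] by (simp add: s_def)
      then show ?case using elim by (meson le_less_trans norm_ge_zero power_mono)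
    qed
    then show "\<forall>\<^sub>F k in sequentially. (norm (s k - T u))\<^sup>2 < a + e"
      by (subst (asm) eventually_sequentially_Suc)
  qed
  then have "F ((1 / 2) *\<^sub>R (u + T u)) \<le> ereal (a - 1 / 4 * (norm (u - T u))\<^sup>2)"
    using midpoint[of u a "T u" a] a by simp
  with u[of "(1 / 2) *\<^sub>R (u + T u)"] a have "ereal a \<le> ereal (a - 1 / 4 * (norm (u - T u))\<^sup>2)"
    by (metis order_trans)
  then have "T u = u" by simp
  then show ?thesis by blast
qed

lemma nonexpansive_fixpoint_iff_bounded_orbit:
  fixes T :: "'a::{real_inner, complete_space} \<Rightarrow> 'a"
  assumes "\<And>x y. norm (T x - T y) \<le> norm (x - y)"
  shows "(\<exists>u. T u = u) \<longleftrightarrow> (\<exists>p. bounded (range (\<lambda>k. (T ^^ k) p)))"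
proof
  assume "\<exists>u. T u = u"
  then obtain u where u: "T u = u" by blast
  have "(T ^^ k) u = u" for k by (induction k) (simp_all add: u)
  then have "bounded (range (\<lambda>k. (T ^^ k) u))" by simp
  then show "\<exists>p. bounded (range (\<lambda>k. (T ^^ k) p))" by blast
qed (use nonexpansive_bounded_orbit_fixpoint[of T] assms in blast)


section \<open>Accelerated Douglas--Rachford splitting\<close>

text \<open>
  The inequality sums strong monotonicity of \<open>A\<close> at \<open>x'\<close> and \<open>xs\<close> with monotonicity of \<open>B\<close> at \<open>z\<close> and \<open>xs\<close>.
  In coordinates centred at the solution, the relations between the iterates turn the
  sum of the two inner products into a telescoping difference of energies minus a square.
\<close>
lemma Douglas_Rachford_energy_decrease:
  fixes xs :: "'a::real_inner"
  assumes A: "strongly_monotone m A" and B: "strongly_monotone 0 B" and r: "r > 0"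
    and a: "a \<in> A xs" "- a \<in> B xs"
    and w: "w \<in> B z" "z + r *\<^sub>R w = x - r *\<^sub>R y"
    and y': "y' \<in> A x'" "x' + r *\<^sub>R y' = z + r *\<^sub>R y"
  shows "(1 + 2 * r * m) * (norm (x' - xs))\<^sup>2 + r\<^sup>2 * (norm (y' - a))\<^sup>2
    \<le> (norm (x - xs))\<^sup>2 + r\<^sup>2 * (norm (y - a))\<^sup>2"
proof -
  \<comment> \<open>\<open>e\<close>, \<open>p\<close>, \<open>q\<close>, \<open>v\<close> are \<open>x'\<close>, \<open>y'\<close>, \<open>y\<close>, \<open>w\<close> relative to their values at the solution.\<close>
  define e p q v where "e = x' - xs" and "p = y' - a" and "q = y - a" and "v = w + a"
  have z: "z - xs = e - r *\<^sub>R q + r *\<^sub>R p"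
    using y'(2) by (simp add: e_def p_def q_def algebra_simps)
  have "x = z + r *\<^sub>R w + r *\<^sub>R y" using w(2) by simp
  also have "z = x' + r *\<^sub>R y' - r *\<^sub>R y" using y'(2) by simp
  finally have x: "x - xs = e + r *\<^sub>R (v + p)"
    by (simp add: e_def p_def v_def algebra_simps)
  have "m * (norm e)\<^sup>2 \<le> inner p e"
    using A y'(1) a(1) unfolding strongly_monotone_def e_def p_def by blast
  moreover have "0 \<le> inner v (z - xs)"
    using B w(1) a(2) unfolding strongly_monotone_def v_def by fastforce
  ultimately have "2 * r * (m * (norm e)\<^sup>2) \<le> 2 * r * (inner p e + inner v (z - xs))"
    using r by (intro mult_left_mono) auto
  also have "\<dots> = (norm (x - xs))\<^sup>2 + r\<^sup>2 * (norm q)\<^sup>2 - (norm e)\<^sup>2 - r\<^sup>2 * (norm p)\<^sup>2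
      - r\<^sup>2 * (norm (v + q))\<^sup>2"
    unfolding z x power2_norm_eq_inner
    by (simp add: inner_simps inner_commute power2_eq_square algebra_simps)
  also have "\<dots> \<le> (norm (x - xs))\<^sup>2 + r\<^sup>2 * (norm q)\<^sup>2 - (norm e)\<^sup>2 - r\<^sup>2 * (norm p)\<^sup>2"
    by simp
  finally show ?thesis by (simp add: e_def p_def q_def algebra_simps)
qed

text \<open>
  The reciprocals \<open>s = 1/r\<close> satisfy \<open>s\<^sub>+\<^sup>2 = s\<^sup>2 + 2ms\<close>, so \<open>s\<close> grows by at least a fixed amount in each
  step and \<open>r\<close> decays like \<open>1/k\<close>.
\<close>
lemma accelerated_step_sizes:
  fixes r :: "nat \<Rightarrow> real"
  assumes pos: "\<And>k. r k > 0" and m: "m > 0"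
    and rec: "\<And>k. r (Suc k) = r k / sqrt (1 + 2 * r k * m)"
  shows "\<exists>C. \<forall>k. r k * real k \<le> C"
proof -
  define s where "s k = 1 / r k" for k
  have s_pos: "s k > 0" for k using pos by (simp add: s_def)
  \<comment> \<open>\<open>s\<^sub>+ - s = 2ms / (s\<^sub>+ + s)\<close> with \<open>s\<^sub>+ \<le> s + m\<close> is at least \<open>2ms / (2s + m)\<close>, so the smaller
      \<open>ms / (s + m)\<close> is a lower bound that increases with \<open>s\<close>; \<open>d\<close> is its value at \<open>s 0\<close>.\<close>
  define d where "d = m / (1 + m / s 0)"
  have d: "d > 0" using m s_pos[of 0] by (simp add: d_def add_pos_pos)
  have sq: "(s (Suc k))\<^sup>2 = (s k)\<^sup>2 + 2 * m * s k" for k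
  proof -
    have "1 + 2 * r k * m > 0" using pos[of k] m by (simp add: add_pos_pos)
    then show ?thesis
      using pos[of k] by (simp add: s_def rec power_divide field_simps power2_eq_square)
  qed
  have up: "s (Suc k) \<ge> s k + d" if "s k \<ge> s 0" for k
  proof (rule power2_le_imp_le)
    have "d * (1 + m / s 0) = m" using m s_pos[of 0] by (simp add: d_def add_pos_pos less_imp_neq[symmetric])
    have "d \<le> m" using m s_pos[of 0] by (simp add: d_def divide_le_eq add_pos_pos)
    have "d * m / s k \<le> d * m / s 0" using that m d s_pos[of 0] by (simp add: frac_le)
    then have "d + d * m / s k \<le> m"
      using \<open>d * (1 + m / s 0) = m\<close> by (simp add: distrib_left)
    then have "d * s k + d * m \<le> m * s k" using s_pos[of k] by (simp add: field_simps)
    moreover have "d * d \<le> d * m" using \<open>d \<le> m\<close> d by simp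
    moreover have "d * m \<ge> 0" using d m by simp
    ultimately show "(s k + d)\<^sup>2 \<le> (s (Suc k))\<^sup>2"
      unfolding sq by (simp add: power2_eq_square algebra_simps)
    show "0 \<le> s (Suc k)" using s_pos less_imp_le by blast
  qed
  have "s k \<ge> s 0 + d * real k" for k
  proof (induction k)
    case (Suc k)
    moreover have "d * real k \<ge> 0" using d by simp
    ultimately have "s (Suc k) \<ge> s k + d" by (intro up) linarith
    with Suc show ?case by (simp add: algebra_simps)
  qed simp
  then have dk: "d * real k \<le> s k" for k using s_pos[of 0] by (smt (verit))
  have "d * real k * r k \<le> 1" for k
    using dk[of k] pos[of k] by (simp add: s_def pos_le_divide_eq)
  then have "r k * real k \<le> 1 / d" for k
    using d by (simp add: pos_le_divide_eq mult_ac)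
  then show ?thesis by blast
qed

text \<open>
  The recursion for the step sizes is chosen so that dividing the one-step energy inequality by \<open>r\<^sub>k\<^sup>2\<close>
  makes \<open>\<parallel>x\<^sub>k - xs\<parallel>\<^sup>2 / r\<^sub>k\<^sup>2 + \<parallel>y\<^sub>k - a\<parallel>\<^sup>2\<close> nonincreasing. Hence the error is at most a constant
  times \<open>r\<^sub>k\<close>.
\<close>
lemma accelerated_Douglas_Rachford_rate:
  fixes x y z :: "nat \<Rightarrow> 'a::real_inner" and r :: "nat \<Rightarrow> real"
  assumes A: "strongly_monotone m A" and B: "strongly_monotone 0 B" and m: "m > 0"
    and r: "\<And>k. r k > 0" "\<And>k. r (Suc k) = r k / sqrt (1 + 2 * r k * m)"
    and a: "a \<in> A xs" "- a \<in> B xs"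
    and z: "\<And>k. k \<ge> 1 \<Longrightarrow> z k \<in> resolvent_set (r k) B (x k - r k *\<^sub>R y k)"
    and x: "\<And>k. k \<ge> 1 \<Longrightarrow> x (Suc k) \<in> resolvent_set (r k) A (z k + r k *\<^sub>R y k)"
    and y: "\<And>k. k \<ge> 1 \<Longrightarrow> y (Suc k) = (1 / r k) *\<^sub>R (z k + r k *\<^sub>R y k - x (Suc k))"
  shows "\<exists>C. \<forall>k\<ge>1. real k * norm (x k - xs) \<le> C"
proof -
  define E where "E k = (norm (x k - xs))\<^sup>2 / (r k)\<^sup>2 + (norm (y k - a))\<^sup>2" for k
  have dec: "E (Suc k) \<le> E k" if k: "k \<ge> 1" for k
  proof -
    obtain w where w: "w \<in> B (z k)" "x k - r k *\<^sub>R y k = z k + r k *\<^sub>R w"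
      using z[OF k] by (auto simp: resolvent_set_def)
    have "y (Suc k) \<in> A (x (Suc k))"
      unfolding y[OF k] by (rule resolvent_residual) (use x[OF k] r in auto)
    moreover have "x (Suc k) + r k *\<^sub>R y (Suc k) = z k + r k *\<^sub>R y k"
      unfolding y[OF k] using r(1)[of k] by simp
    ultimately have le: "(1 + 2 * r k * m) * (norm (x (Suc k) - xs))\<^sup>2 + (r k)\<^sup>2 * (norm (y (Suc k) - a))\<^sup>2
        \<le> (norm (x k - xs))\<^sup>2 + (r k)\<^sup>2 * (norm (y k - a))\<^sup>2"
      by (intro Douglas_Rachford_energy_decrease[OF A B r(1) a w(1) w(2)[symmetric]])
    have q: "1 + 2 * r k * m > 0" using r(1)[of k] m by (simp add: add_pos_pos)
    then have "(r k)\<^sup>2 = (1 + 2 * r k * m) * (r (Suc k))\<^sup>2" by (simp add: r(2) power_divide)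
    then have "(r k)\<^sup>2 * ((norm (x (Suc k) - xs))\<^sup>2 / (r (Suc k))\<^sup>2)
        = (1 + 2 * r k * m) * (norm (x (Suc k) - xs))\<^sup>2"
      using r(1)[of "Suc k"] by simp
    then have "(r k)\<^sup>2 * E (Suc k)
        = (1 + 2 * r k * m) * (norm (x (Suc k) - xs))\<^sup>2 + (r k)\<^sup>2 * (norm (y (Suc k) - a))\<^sup>2"
      by (simp add: E_def distrib_left)
    also note le
    also have "(norm (x k - xs))\<^sup>2 + (r k)\<^sup>2 * (norm (y k - a))\<^sup>2 = (r k)\<^sup>2 * E k"
      using r(1)[of k] by (simp add: E_def distrib_left)
    finally show ?thesis using r(1)[of k] by simp
  qed
  have E_le: "E k \<le> E 1" if "k \<ge> 1" for k
    using that by (induction k rule: dec_induct) (use dec order_trans in fastforce)+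
  obtain C where C: "\<And>k. r k * real k \<le> C" using accelerated_step_sizes[of r m, OF r(1) m r(2)] by blast
  have "real k * norm (x k - xs) \<le> C * sqrt (E 1)" if "k \<ge> 1" for k
  proof -
    have "(norm (x k - xs) / r k)\<^sup>2 \<le> E k" by (simp add: E_def power_divide)
    also note E_le[OF that]
    finally have "norm (x k - xs) / r k \<le> sqrt (E 1)" by (rule real_le_rsqrt)
    then have "norm (x k - xs) \<le> r k * sqrt (E 1)" using r(1)[of k] by (simp add: field_simps)
    then have "real k * norm (x k - xs) \<le> real k * (r k * sqrt (E 1))" by (intro mult_left_mono) auto
    also have "\<dots> = r k * real k * sqrt (E 1)" by simp
    also have "\<dots> \<le> C * sqrt (E 1)"
      using C[of k] by (intro mult_right_mono) (auto simp: E_def)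
    finally show ?thesis .
  qed
  then show ?thesis by blast
qed


section \<open>Resolvents of sums of subdifferentials\<close>

theorem corollary5p2:
  fixes ft gt f g :: "'a::{real_inner, complete_space} \<Rightarrow> ereal"
    and \<gamma> \<omega> \<beta> \<rho> :: real
    and r :: "nat \<Rightarrow> real"
    and x y z :: "nat \<Rightarrow> 'a"
    and A B :: "'a \<Rightarrow> 'a set"
    and T :: "'a \<Rightarrow> 'a"
  assumes ft: "proper_fun ft" "lsc_fun ft" "strongly_convex_fun \<gamma> ft"
    and gt: "proper_fun gt" "lsc_fun gt" "weakly_convex_fun \<omega> gt"
    and params: "\<gamma> > 0" "\<omega> > 0" "\<gamma> > \<omega>" "\<beta> \<in> {0<..<1}"
    and r_range: "\<And>k. r k \<in> {0<..<2 * (1 - \<beta>) / \<beta>}"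
    and r_Suc: "\<And>k. r (Suc k) = r k / sqrt (1 + 2 * r k * (1 - \<beta>) / \<beta>)"
    and f: "f = (\<lambda>u. ereal (1 / (\<gamma> - \<omega>)) * (ft u - ereal (\<gamma> / 2 * (norm u)\<^sup>2)))"
    and g: "g = (\<lambda>u. ereal (1 / (\<gamma> - \<omega>)) * (gt u + ereal (\<omega> / 2 * (norm u)\<^sup>2)))"
    and x_0: "x 0 = \<beta> *\<^sub>R prox (2 * r 0 * (1 - \<beta>) / (\<beta> + r 0 * (1 - \<beta>))) f
                ((1 / (\<beta> + r 0 * (1 - \<beta>))) *\<^sub>R z 0)"
    and y_0: "y 0 = (1 / r 0) *\<^sub>R (z 0 - x 0)"
    and x_rec: "\<And>k. k \<ge> 1 \<Longrightarrow>
          x k = \<beta> *\<^sub>R prox (2 * r (k - 1) * (1 - \<beta>) / (\<beta> + r (k - 1) * (1 - \<beta>))) f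
            ((1 / (\<beta> + r (k - 1) * (1 - \<beta>))) *\<^sub>R (z (k - 1) + r (k - 1) *\<^sub>R y (k - 1)))"
    and y_rec: "\<And>k. k \<ge> 1 \<Longrightarrow>
          y k = (1 / r (k - 1)) *\<^sub>R (z (k - 1) + r (k - 1) *\<^sub>R y (k - 1) - x k)"
    and z_rec: "\<And>k. k \<ge> 1 \<Longrightarrow>
          z k = \<beta> *\<^sub>R prox (2 * r k * (1 - \<beta>) / (\<beta> + r k * (1 - \<beta>))) g
            ((1 / (\<beta> + r k * (1 - \<beta>))) *\<^sub>R (x k - r k *\<^sub>R y k))"
    and \<rho>: "\<rho> > 0"
    and A: "A = subdiff f"
    and B: "B = subdiff g"
    and T: "T = reflected_resolvent \<rho> (beta_op \<beta> B) \<circ> reflected_resolvent \<rho> (beta_op \<beta> A)"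
  shows "(resolvent_set 1 (\<lambda>u. subdiff f u + subdiff g u) 0 \<noteq> {}
            \<longleftrightarrow> (\<exists>p. bounded (range (\<lambda>k. (T ^^ k) p))))
       \<and> (resolvent_set 1 (\<lambda>u. subdiff f u + subdiff g u) 0 \<noteq> {} \<longrightarrow>
            (\<exists>xstar. (\<forall>u. is_arg_min (\<lambda>v. ft v + gt v) (\<lambda>_. True) u \<longleftrightarrow> u = xstar)
               \<and> (\<lambda>k. (1 / \<beta>) *\<^sub>R x k) \<longlonglongrightarrow> xstar
               \<and> (\<lambda>k. norm ((1 / \<beta>) *\<^sub>R x (k + 1) - xstar)) \<in> O(\<lambda>k. 1 / real k)))"
proof -
  define m where "m = (1 - \<beta>) / \<beta>"
  have \<beta>: "0 < \<beta>" "\<beta> < 1" and m: "m > 0" using params(4) by (auto simp: m_def)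
  have c: "1 / (\<gamma> - \<omega>) > 0" using params(3) by simp
  have ft_MInf: "ft u \<noteq> -\<infinity>" and gt_MInf: "gt u \<noteq> -\<infinity>" for u
    using ft(1) gt(1) by (auto simp: proper_fun_def)

  have f': "f = (\<lambda>u. ereal (1 / (\<gamma> - \<omega>)) * (ft u + ereal (- (\<gamma> / 2 * (norm u)\<^sup>2))))"
    unfolding f by (simp add: minus_ereal_def)
  have f_props: "proper_fun f" "lsc_fun f" "convex_fun f"
    unfolding f'
    by (intro proper_fun_scale_add lsc_fun_scale_add convex_fun_scale strongly_convex_minus_square_convex
        ft c ft_MInf continuous_intros; use ft_MInf in \<open>simp\<close>)+
  have g_props: "proper_fun g" "lsc_fun g" "convex_fun g"
    unfolding g
    by (intro proper_fun_scale_add lsc_fun_scale_add convex_fun_scale gt(3)[unfolded weakly_convex_fun_def]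
        gt(1,2) c continuous_intros; use gt_MInf in \<open>simp\<close>)+

  define A' B' where "A' = beta_op \<beta> (subdiff f)" and "B' = beta_op \<beta> (subdiff g)"
  have strong: "strongly_monotone m A'" "strongly_monotone m B'"
    unfolding A'_def B'_def m_def
    by (intro beta_op_strongly_monotone subdiff_monotone f_props g_props \<beta>)+
  then have mono: "strongly_monotone 0 A'" "strongly_monotone 0 B'"
    using m by (auto elim: strongly_monotone_mono)
  have step_f: "\<beta> *\<^sub>R prox (2 * s * (1 - \<beta>) / (\<beta> + s * (1 - \<beta>))) f ((1 / (\<beta> + s * (1 - \<beta>))) *\<^sub>R w)
      \<in> resolvent_set s A' w"
    and step_g: "\<beta> *\<^sub>R prox (2 * s * (1 - \<beta>) / (\<beta> + s * (1 - \<beta>))) g ((1 / (\<beta> + s * (1 - \<beta>))) *\<^sub>R w)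
      \<in> resolvent_set s B' w" if "s > 0" for s w
    unfolding A'_def B'_def using that
    by (intro prox_in_resolvent_set_beta_op f_props g_props \<beta>; simp)+
  then have total: "resolvent_set \<rho> A' p \<noteq> {}" "resolvent_set \<rho> B' p \<noteq> {}" for p
    using \<rho> by blast+
  have zero_iff: "(\<exists>a\<in>A' v. - a \<in> B' v)
      \<longleftrightarrow> (1 / \<beta>) *\<^sub>R v \<in> resolvent_set 1 (\<lambda>u. subdiff f u + subdiff g u) 0" for v
    unfolding A'_def B'_def by (rule beta_op_common_zero_iff[OF \<beta>])
  have T': "T = reflected_resolvent \<rho> B' \<circ> reflected_resolvent \<rho> A'"
    by (simp add: T A B A'_def B'_def)

  have "(\<exists>p. bounded (range (\<lambda>k. (T ^^ k) p))) \<longleftrightarrow> (\<exists>p. T p = p)"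
  proof (rule nonexpansive_fixpoint_iff_bounded_orbit[symmetric])
    show "norm (T u - T v) \<le> norm (u - v)" for u v
      unfolding T' o_def
      by (meson order_trans reflected_resolvent_nonexpansive mono \<rho> total)
  qed
  also have "\<dots> \<longleftrightarrow> (\<exists>v. \<exists>a\<in>A' v. - a \<in> B' v)"
    unfolding T' by (rule reflected_resolvent_comp_fixpoint_iff[OF mono \<rho> total])
  also have "\<dots> \<longleftrightarrow> resolvent_set 1 (\<lambda>u. subdiff f u + subdiff g u) 0 \<noteq> {}"
  proof
    assume "resolvent_set 1 (\<lambda>u. subdiff f u + subdiff g u) 0 \<noteq> {}"
    then obtain u where "u \<in> resolvent_set 1 (\<lambda>u. subdiff f u + subdiff g u) 0" by blast
    then show "\<exists>v. \<exists>a\<in>A' v. - a \<in> B' v" using zero_iff[of "\<beta> *\<^sub>R u"] \<beta> by auto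
  qed (use zero_iff in blast)
  finally have existence: "resolvent_set 1 (\<lambda>u. subdiff f u + subdiff g u) 0 \<noteq> {}
      \<longleftrightarrow> (\<exists>p. bounded (range (\<lambda>k. (T ^^ k) p)))" by blast

  have convergence: "(\<forall>v. is_arg_min (\<lambda>v. ft v + gt v) (\<lambda>_. True) v \<longleftrightarrow> v = u)
      \<and> (\<lambda>k. (1 / \<beta>) *\<^sub>R x k) \<longlonglongrightarrow> u
      \<and> (\<lambda>k. norm ((1 / \<beta>) *\<^sub>R x (k + 1) - u)) \<in> O(\<lambda>k. 1 / real k)"
    if u: "u \<in> resolvent_set 1 (\<lambda>u. subdiff f u + subdiff g u) 0" for u
  proof (intro conjI allI)
    show "is_arg_min (\<lambda>v. ft v + gt v) (\<lambda>_. True) v \<longleftrightarrow> v = u" for v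
    proof (rule resolvent_at_zero_unique_minimizer[OF f_props(1) g_props(1) c _ u])
      fix v :: 'a
      \<comment> \<open>The quadratic terms of \<open>f\<close> and \<open>g\<close> add up to \<open>(\<omega> - \<gamma>) / (2(\<gamma> - \<omega>)) = -1/2\<close> times the squared norm.\<close>
      have "1 / (\<gamma> - \<omega>) * (- (\<gamma> / 2 * (norm v)\<^sup>2) + \<omega> / 2 * (norm v)\<^sup>2) + (norm v)\<^sup>2 / 2 = 0"
        using params(3) by (simp add: field_simps)
      then show "f v + g v + ereal ((norm v)\<^sup>2 / 2) = ereal (1 / (\<gamma> - \<omega>)) * (ft v + gt v)"
        unfolding f' g using c ft_MInf[of v] gt_MInf[of v]
        by (cases "ft v"; cases "gt v") (simp_all add: algebra_simps add_divide_distrib)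
    qed
    obtain a where a: "a \<in> A' (\<beta> *\<^sub>R u)" "- a \<in> B' (\<beta> *\<^sub>R u)"
      using zero_iff[of "\<beta> *\<^sub>R u"] \<beta> u by auto
    have r_pos: "r k > 0" for k using r_range[of k] by simp
    have "\<exists>C. \<forall>k\<ge>1. real k * norm (x k - \<beta> *\<^sub>R u) \<le> C"
    proof (rule accelerated_Douglas_Rachford_rate[OF strong(1) mono(2) m r_pos _ a])
      show "r (Suc k) = r k / sqrt (1 + 2 * r k * m)" for k
        using r_Suc[of k] by (simp add: m_def)
      show "z k \<in> resolvent_set (r k) B' (x k - r k *\<^sub>R y k)" if "k \<ge> 1" for k
        unfolding z_rec[OF that] by (rule step_g[OF r_pos])
      show "x (Suc k) \<in> resolvent_set (r k) A' (z k + r k *\<^sub>R y k)" for k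
        using x_rec[of "Suc k"] step_f[OF r_pos[of k]] by simp
      show "y (Suc k) = (1 / r k) *\<^sub>R (z k + r k *\<^sub>R y k - x (Suc k))" for k
        using y_rec[of "Suc k"] by simp
    qed
    then obtain C where C: "\<And>k. k \<ge> 1 \<Longrightarrow> real k * norm (x k - \<beta> *\<^sub>R u) \<le> C" by blast
    have bound: "norm ((1 / \<beta>) *\<^sub>R x k - u) \<le> C / \<beta> * (1 / real k)" if "k \<ge> 1" for k
    proof -
      have "(1 / \<beta>) *\<^sub>R x k - u = (1 / \<beta>) *\<^sub>R (x k - \<beta> *\<^sub>R u)"
        using \<beta> by (simp add: scaleR_diff_right)
      then have "norm ((1 / \<beta>) *\<^sub>R x k - u) = norm (x k - \<beta> *\<^sub>R u) / \<beta>" using \<beta> by simp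
      also have "\<dots> \<le> C / real k / \<beta>"
        using C[OF that] that \<beta> by (intro divide_right_mono) (auto simp: field_simps)
      finally show ?thesis by (simp add: mult.commute)
    qed
    have "(\<lambda>k. (1 / \<beta>) *\<^sub>R x k - u) \<longlonglongrightarrow> 0"
    proof (rule Lim_null_comparison)
      show "\<forall>\<^sub>F k in sequentially. norm ((1 / \<beta>) *\<^sub>R x k - u) \<le> C / \<beta> * (1 / real k)"
        using bound by (auto intro: eventually_sequentiallyI[of 1])
      show "(\<lambda>k. C / \<beta> * (1 / real k)) \<longlonglongrightarrow> 0"
        using tendsto_mult_left[OF lim_1_over_n, of "C / \<beta>"] by simp
    qed
    then show "(\<lambda>k. (1 / \<beta>) *\<^sub>R x k) \<longlonglongrightarrow> u" by (simp add: LIM_zero_iff)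
    have C_nonneg: "0 \<le> C" using order_trans[OF norm_ge_zero, of "x 1 - \<beta> *\<^sub>R u" C] C[of 1] by simp
    show "(\<lambda>k. norm ((1 / \<beta>) *\<^sub>R x (k + 1) - u)) \<in> O(\<lambda>k. 1 / real k)"
    proof (rule bigoI[where c = "C / \<beta>"], rule eventually_sequentiallyI[of 1])
      fix k :: nat assume k: "1 \<le> k"
      have "norm ((1 / \<beta>) *\<^sub>R x (k + 1) - u) \<le> C / \<beta> * (1 / real (k + 1))" by (rule bound) simp
      also have "\<dots> \<le> C / \<beta> * (1 / real k)"
        using C_nonneg \<beta> k by (intro mult_left_mono) (auto simp: frac_le)
      finally show "norm (norm ((1 / \<beta>) *\<^sub>R x (k + 1) - u)) \<le> C / \<beta> * norm (1 / real k)" by simp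
    qed
  qed
  show ?thesis using existence convergence by blast
qed

end
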